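(* Let $M$ be an EMV-algebra. The following are equivalent: (i) the state space $\mathcal S(M)$ is locally compact in the weak topology; (ii) $\mathcal S(M)$ is compact in the weak topology; (iii) $M$ has a top element.
   Context: An EMV-algebra is an algebra $(M;\vee,\wedge,\oplus,0)$ of type $\langle 2,2,2,0\rangle$ such that: (i) $(M;\oplus,0)$ is a commutative monoid with neutral element $0$; (ii) $(M;\vee,\wedge,0)$ is a distributive lattice with bottom element $0$ (order $\le$); (iii) for each idempotent $a$ ($a\oplus a=a$; set $\mathcal I(M)$), $([0,a];\oplus,\lambda_a,0,a)$ is an MV-algebra, where $[0,a]=\{x:0\le x\le a\}$ and $\lambda_a(x)=\min\{z\in[0,a]:z\oplus x=a\}$; (iv) each element lies below some idempotent. A top element is a greatest element of $(M,\le)$. For $x,y\le a\in\mathcal I(M)$, $x\odot y=\lambda_a(\lambda_a(x)\oplus\lambda_a(y))$; $x+y$ is defined iff $x\odot y=0$ and then equals $x\oplus y$. A state is a map $s:M\to[0,1]$ with $s(x+y)=s(x)+s(y)$ whenever $x+y$ is defined and $s(a)=1$ for some $a\in M$; $\mathcal S(M)$ is the set of states, equipped with the weak topology, i.e. the topology induced by the product topology of $[0,1]^M$. *)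

theory Defs
  imports "HOL-Analysis.Analysis"
begin

section \<open>MV-algebras on a carrier set\<close>

locale mv_algebra_on =
  fixes A :: "'a set"
    and p :: "'a \<Rightarrow> 'a \<Rightarrow> 'a"
    and n :: "'a \<Rightarrow> 'a"
    and z :: 'a
    and u :: 'a
  assumes p_closed: "x \<in> A \<Longrightarrow> y \<in> A \<Longrightarrow> p x y \<in> A"
    and n_closed: "x \<in> A \<Longrightarrow> n x \<in> A"
    and z_closed: "z \<in> A"
    and p_assoc: "x \<in> A \<Longrightarrow> y \<in> A \<Longrightarrow> w \<in> A \<Longrightarrow> p (p x y) w = p x (p y w)"
    and p_comm: "x \<in> A \<Longrightarrow> y \<in> A \<Longrightarrow> p x y = p y x"
    and p_neutral: "x \<in> A \<Longrightarrow> p x z = x"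
    and n_n: "x \<in> A \<Longrightarrow> n (n x) = x"
    and n_z: "n z = u"
    and p_u: "x \<in> A \<Longrightarrow> p x u = u"
    and lukasiewicz: "x \<in> A \<Longrightarrow> y \<in> A \<Longrightarrow> p (n (p (n x) y)) y = p (n (p (n y) x)) x"


section \<open>EMV-algebras\<close>

class emv_signature = distrib_lattice + zero +
  fixes oplus :: "'a \<Rightarrow> 'a \<Rightarrow> 'a"  (infixl \<open>\<oplus>\<close> 65)
begin

definition idem :: "'a \<Rightarrow> bool"
  where "idem a \<longleftrightarrow> a \<oplus> a = a"

text \<open>The operation \<open>\<lambda>\<^sub>a\<close>. It is only meaningful if the minimum exists; for \<open>x \<in> [0,a]\<close>,
  \<open>a\<close> idempotent, this existence is an axiom of the class \<open>emv_algebra\<close> below.\<close>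

definition lam :: "'a \<Rightarrow> 'a \<Rightarrow> 'a"
  where "lam a x = (LEAST w. w \<in> {0..a} \<and> w \<oplus> x = a)"

end

class emv_algebra = emv_signature +
  assumes oplus_assoc: "(x \<oplus> y) \<oplus> w = x \<oplus> (y \<oplus> w)"
    and oplus_comm: "x \<oplus> y = y \<oplus> x"
    and oplus_zero: "x \<oplus> 0 = x"
    and zero_least: "0 \<le> x"
    and lam_exists: "idem a \<Longrightarrow> x \<in> {0..a} \<Longrightarrow>
      \<exists>w. w \<in> {0..a} \<and> w \<oplus> x = a \<and> (\<forall>v. v \<in> {0..a} \<and> v \<oplus> x = a \<longrightarrow> w \<le> v)"
    and interval_mv: "idem a \<Longrightarrow> mv_algebra_on {0..a} (\<oplus>) (lam a) 0 a"
    and below_idem: "\<exists>a. idem a \<and> x \<le> a"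
begin

definition odot_in :: "'a \<Rightarrow> 'a \<Rightarrow> 'a \<Rightarrow> 'a"
  where "odot_in a x y = lam a (lam a x \<oplus> lam a y)"

text \<open>The product does not depend on the idempotent bound that is chosen; see
  \<open>odot_eq_odot_in\<close> below.\<close>

definition odot :: "'a \<Rightarrow> 'a \<Rightarrow> 'a"  (infixl \<open>\<odot>\<close> 70)
  where "x \<odot> y = odot_in (SOME a. idem a \<and> x \<le> a \<and> y \<le> a) x y"

lemma lam_props:
  assumes "idem a" "x \<in> {0..a}"
  shows "lam a x \<in> {0..a}" "lam a x \<oplus> x = a"
    and "\<And>v. v \<in> {0..a} \<Longrightarrow> v \<oplus> x = a \<Longrightarrow> lam a x \<le> v"
proof -
  obtain w where w: "w \<in> {0..a} \<and> w \<oplus> x = a"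
      "\<And>v. v \<in> {0..a} \<and> v \<oplus> x = a \<Longrightarrow> w \<le> v"
    using lam_exists[OF assms] by blast
  have "lam a x = w"
    unfolding lam_def by (rule Least_equality) (use w in auto)
  then show "lam a x \<in> {0..a}" "lam a x \<oplus> x = a"
    and "\<And>v. v \<in> {0..a} \<Longrightarrow> v \<oplus> x = a \<Longrightarrow> lam a x \<le> v"
    using w by auto
qed

lemma oplus_idem_bound:
  assumes "idem a" "x \<in> {0..a}"
  shows "x \<oplus> a = a"
  using mv_algebra_on.p_u[OF interval_mv] assms by blast

lemma lam_mono_bound:
  assumes a: "idem a" and b: "idem b" and ab: "a \<le> b" and x: "x \<in> {0..a}"
  shows "lam a x = lam b (lam b a \<oplus> x)"
proof -
  interpret B: mv_algebra_on "{0..b}" "(\<oplus>)" "lam b" 0 b by (rule interval_mv[OF b])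
  have ain: "a \<in> {0..b}" and xin: "x \<in> {0..b}"
    using ab x zero_least by auto
  have na: "lam b a \<oplus> a = b" "lam b a \<in> {0..b}" using lam_props[OF b ain] by auto
  have nx: "lam b x \<oplus> x = b" "lam b x \<in> {0..b}" using lam_props[OF b xin] by auto
  let ?c = "lam b a \<oplus> x" and ?m = "lam b (lam b a \<oplus> x)"
  have c: "?c \<in> {0..b}" using B.p_closed na xin by blast
  have m_least: "?m \<le> v" if v: "v \<in> {0..b}" "v \<oplus> ?c = b" for v
    using lam_props(3)[OF b c v] .
  have "a \<oplus> ?c = b"
    by (metis na(1) oplus_comm oplus_assoc oplus_idem_bound[OF b xin])
  then have ma: "?m \<le> a" using m_least ain by blast
  have nxa: "lam b x \<oplus> a = b"
    by (metis nx(1) oplus_assoc oplus_comm oplus_idem_bound[OF a x] oplus_idem_bound[OF b ain])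
  have nb: "lam b b = 0"
    using B.n_n[OF B.z_closed] B.n_z by simp
  have "?m \<oplus> x = lam b (lam b x \<oplus> a) \<oplus> a"
    using B.lukasiewicz[OF ain xin] .
  also have "\<dots> = a" by (metis nxa nb oplus_comm oplus_zero)
  finally have mx: "?m \<oplus> x = a" .
  show ?thesis
    unfolding lam_def[of a x]
  proof (rule Least_equality)
    show "?m \<in> {0..a} \<and> ?m \<oplus> x = a" using ma mx zero_least by auto
  next
    fix v assume v: "v \<in> {0..a} \<and> v \<oplus> x = a"
    have "v \<oplus> ?c = b" by (metis v na(1) oplus_comm oplus_assoc)
    then show "?m \<le> v" using m_least v ab by auto
  qed
qed

lemma odot_in_mono:
  assumes a: "idem a" and b: "idem b" and ab: "a \<le> b"
    and x: "x \<in> {0..a}" and y: "y \<in> {0..a}"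
  shows "odot_in a x y = odot_in b x y"
proof -
  interpret B: mv_algebra_on "{0..b}" "(\<oplus>)" "lam b" 0 b by (rule interval_mv[OF b])
  interpret A: mv_algebra_on "{0..a}" "(\<oplus>)" "lam a" 0 a by (rule interval_mv[OF a])
  have ain: "a \<in> {0..b}" using ab zero_least by auto
  have na: "lam b a \<oplus> a = b" "lam b a \<in> {0..b}" using lam_props[OF b ain] by auto
  have nb: "lam b b = 0"
    using B.n_n[OF B.z_closed] B.n_z by simp
  let ?d = "lam b a"
  have dd: "?d \<oplus> ?d \<in> {0..b}" using B.p_closed na by blast
  have "lam b (?d \<oplus> ?d) \<oplus> ?d = lam b (a \<oplus> a) \<oplus> a"
    using B.lukasiewicz[OF ain na(2)] B.n_n[OF ain] by simp
  also have "\<dots> = b" using a na(1) by (simp add: idem_def)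
  finally have "lam b (lam b (?d \<oplus> ?d)) \<le> ?d"
    using lam_props(3)[OF b, of "lam b (?d \<oplus> ?d)" ?d] lam_props(1)[OF b dd] na(2)
    by (metis oplus_comm)
  then have 1: "?d \<oplus> ?d \<le> ?d" using B.n_n[OF dd] by simp
  have "?d \<oplus> ?d \<oplus> a = b" 
    by (metis na oplus_assoc oplus_idem_bound[OF b])
  then have 2: "?d \<le> ?d \<oplus> ?d"
    using lam_props(3)[OF b ain dd] by simp
  from 1 2 have d: "?d \<oplus> ?d = ?d" by simp
  have key: "?d \<oplus> lam a v = lam b v" if v: "v \<in> {0..a}" for v
  proof -
    have vin: "v \<in> {0..b}" using v ab by auto
    have nv: "lam b v \<oplus> v = b" "lam b v \<in> {0..b}" using lam_props[OF b vin] by auto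
    have nva: "a \<oplus> lam b v = b"
      by (metis nv(1) oplus_assoc oplus_comm oplus_idem_bound[OF a v] oplus_idem_bound[OF b ain])
    have "lam b (v \<oplus> ?d) \<oplus> ?d = lam b (a \<oplus> lam b v) \<oplus> lam b v"
      using B.lukasiewicz[OF nv(2) na(2)] B.n_n[OF vin] B.n_n[OF ain] by simp
    also have "\<dots> = lam b v" by (metis nva nb oplus_comm oplus_zero)
    finally show ?thesis
      using lam_mono_bound[OF a b ab v] by (metis oplus_comm)
  qed
  have "odot_in a x y = lam b (?d \<oplus> (lam a x \<oplus> lam a y))"
    unfolding odot_in_def
    by (rule lam_mono_bound[OF a b ab]) (use A.p_closed A.n_closed x y in blast)
  also have "?d \<oplus> (lam a x \<oplus> lam a y) = (?d \<oplus> lam a x) \<oplus> (?d \<oplus> lam a y)"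
    by (metis d oplus_assoc oplus_comm)
  finally show ?thesis using key x y by (simp add: odot_in_def)
qed

lemma odot_eq_odot_in:
  assumes a: "idem a" and x: "x \<le> a" and y: "y \<le> a"
  shows "x \<odot> y = odot_in a x y"
proof -
  define b where "b = (SOME a. idem a \<and> x \<le> a \<and> y \<le> a)"
  have b: "idem b \<and> x \<le> b \<and> y \<le> b"
    unfolding b_def by (rule someI[of _ a]) (use assms in auto)
  obtain c where c: "idem c" "sup a b \<le> c" using below_idem by blast
  then have ac: "a \<le> c" and bc: "b \<le> c" by auto
  have "odot_in b x y = odot_in c x y"
    by (rule odot_in_mono) (use b c bc zero_least in auto)
  also have "\<dots> = odot_in a x y"
    by (rule odot_in_mono[symmetric]) (use assms c ac zero_least in auto)
  finally show ?thesis by (simp add: odot_def b_def)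
qed

end


section \<open>States and the weak topology\<close>

text \<open>The partial sum of \<open>x\<close> and \<open>y\<close> is defined iff \<open>x \<odot> y = 0\<close>, and then its value is \<open>x \<oplus> y\<close>.\<close>

definition is_state :: "('a::emv_algebra \<Rightarrow> real) \<Rightarrow> bool"
  where "is_state s \<longleftrightarrow>
    (\<forall>x. s x \<in> {0..1}) \<and>
    (\<forall>x y. x \<odot> y = 0 \<longrightarrow> s (x \<oplus> y) = s x + s y) \<and>
    (\<exists>a. s a = 1)"

definition state_space :: "('a::emv_algebra \<Rightarrow> real) topology"
  where "state_space =
    subtopology (product_topology (\<lambda>_. top_of_set {0..1}) UNIV) {s. is_state s}"

end

(*
  The truncated difference makes M a structure in which all MV-algebra identities that do not
  mention a unit hold globally.

  If M has a top element, the states are a closed subset of the compact cube [0,1]^M. If it has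
  none, then for every idempotent b some state t vanishes at b. Let s be a state with a compact
  neighbourhood K. For a fixed small d > 0 and all sufficiently large b, the mixture
  (1 - d) s + d t lies in K and has value at most 1 - d at b. But the open sets {r. r b > 1 - d}
  form a directed cover of the state space, so one of them contains K, a contradiction.

  The state t is obtained from a prime ideal P avoiding the nonzero idempotent c = a - b, for some
  idempotent a above b: modulo P the algebra is a chain with unit c, and binary expansion in this
  chain is additive in the limit.
*)

theory Submission
  imports Defs
begin

section \<open>Truncated difference\<close>

text \<open>The product of \<open>x\<close> with the complement of \<open>y\<close> in
  \<open>[0,b]\<close>, that is max(x - y, 0) in the real unit interval. Unlike the complement it
  does not depend on \<open>b\<close> (\<open>ominus_eq\<close>), so it is a global
  operation.\<close>

definition ominus :: "'a::emv_algebra \<Rightarrow> 'a \<Rightarrow> 'a"  (infixl \<open>\<ominus>\<close> 65)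
  where "x \<ominus> y = (let b = SOME b. idem b \<and> x \<le> b \<and> y \<le> b in lam b (lam b x \<oplus> y))"

text \<open>The order of the MV-algebras \<open>[0,a]\<close>. The axioms do not force it to agree with the lattice
  order \<open>\<le>\<close>; the two are only known to agree below idempotents, see \<open>le_idem_iff_nle\<close>.\<close>

definition nle :: "'a::emv_algebra \<Rightarrow> 'a \<Rightarrow> bool"  (infix \<open>\<sqsubseteq>\<close> 50)
  where "x \<sqsubseteq> y \<longleftrightarrow> x \<ominus> y = 0"

declare zero_least [simp] oplus_zero [simp]

section \<open>Arithmetic in the intervals below idempotents\<close>

lemma idem_lam_closed:
  fixes b :: "'a::emv_algebra"
  assumes "idem b"
  shows oplus_le: "x \<le> b \<Longrightarrow> y \<le> b \<Longrightarrow> x \<oplus> y \<le> b"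
    and lam_le: "x \<le> b \<Longrightarrow> lam b x \<le> b"
    and lam_lam: "x \<le> b \<Longrightarrow> lam b (lam b x) = x"
    and lam_oplus: "x \<le> b \<Longrightarrow> lam b x \<oplus> x = b"
    and lam_zero: "lam b 0 = b"
    and lam_self: "lam b b = 0"
    and oplus_top: "x \<le> b \<Longrightarrow> x \<oplus> b = b"
    and lam_luk: "x \<le> b \<Longrightarrow> y \<le> b \<Longrightarrow>
      lam b (lam b x \<oplus> y) \<oplus> y = lam b (lam b y \<oplus> x) \<oplus> x"
proof -
  interpret B: mv_algebra_on "{0..b}" "(\<oplus>)" "lam b" 0 b by (rule interval_mv[OF assms])
  show "x \<le> b \<Longrightarrow> y \<le> b \<Longrightarrow> x \<oplus> y \<le> b" using B.p_closed[of x y] by auto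
  show "x \<le> b \<Longrightarrow> lam b x \<le> b" using B.n_closed[of x] by auto
  show "x \<le> b \<Longrightarrow> lam b (lam b x) = x" using B.n_n[of x] by auto
  show "x \<le> b \<Longrightarrow> lam b x \<oplus> x = b" using lam_props(2)[OF assms, of x] by auto
  show "lam b 0 = b" by (rule B.n_z)
  show "lam b b = 0" using B.n_n[OF B.z_closed] B.n_z by simp
  show "x \<le> b \<Longrightarrow> x \<oplus> b = b" using B.p_u[of x] by auto
  show "x \<le> b \<Longrightarrow> y \<le> b \<Longrightarrow> lam b (lam b x \<oplus> y) \<oplus> y = lam b (lam b y \<oplus> x) \<oplus> x"
    using B.lukasiewicz[of x y] by auto
qed

text \<open>Passing from \<open>a\<close> to \<open>b\<close> splits the complement as
  \<open>lam b x = lam b a \<oplus> lam a x\<close>; what remains is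
  \<open>lam_mono_bound\<close>.\<close>

lemma lam_lam_oplus_mono:
  fixes a b :: "'a::emv_algebra"
  assumes a: "idem a" and b: "idem b" and "a \<le> b" "x \<le> a" "y \<le> a"
  shows "lam a (lam a x \<oplus> y) = lam b (lam b x \<oplus> y)"
proof -
  have "x \<le> b" "y \<le> b" using assms by auto
  have e: "lam a (lam a y) = y" "lam b (lam b y) = y"
    using lam_lam assms \<open>y \<le> b\<close> by auto
  have "lam a (lam a x \<oplus> y) = odot_in a x (lam a y)"
    by (simp add: odot_in_def e)
  have la: "lam b (lam b a \<oplus> lam a x) = x"
    using lam_mono_bound[OF a b \<open>a \<le> b\<close>, of "lam a x"] lam_lam[OF a] lam_le[OF a] assms by simp
  have "lam b a \<oplus> lam a x \<le> b"
    using oplus_le[OF b] lam_le[OF b \<open>a \<le> b\<close>] lam_le[OF a \<open>x \<le> a\<close>] \<open>a \<le> b\<close> by auto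
  then have "lam b x = lam b a \<oplus> lam a x" using la lam_lam[OF b] by metis
  moreover have "lam a x \<oplus> y \<in> {0..a}"
    using oplus_le[OF a] lam_le[OF a] assms by auto
  ultimately show ?thesis
    using lam_mono_bound[OF a b \<open>a \<le> b\<close>] by (simp add: oplus_assoc)
qed

lemma ominus_eq:
  assumes a: "idem a" "x \<le> a" "y \<le> a"
  shows "x \<ominus> y = lam a (lam a x \<oplus> y)"
proof -
  define b where "b = (SOME b. idem b \<and> x \<le> b \<and> y \<le> b)"
  have b: "idem b" "x \<le> b" "y \<le> b"
    unfolding b_def atomize_conj by (rule someI[of _ a]; use a in auto)+
  obtain c where c: "idem c" "sup a b \<le> c" using below_idem by blast
  have "lam b (lam b x \<oplus> y) = lam c (lam c x \<oplus> y)"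
    by (rule lam_lam_oplus_mono) (use b c in auto)
  also have "\<dots> = lam a (lam a x \<oplus> y)"
    by (rule lam_lam_oplus_mono[symmetric]) (use a c in auto)
  finally show ?thesis by (simp add: ominus_def Let_def b_def)
qed

lemma idem_bound3:
  fixes x y w :: "'a::emv_algebra"
  obtains b where "idem b" "x \<le> b" "y \<le> b" "w \<le> b"
  using below_idem[of "sup x (sup y w)"] by auto

lemma ominus_le: "idem a \<Longrightarrow> x \<le> a \<Longrightarrow> y \<le> a \<Longrightarrow> x \<ominus> y \<le> a"
  by (simp add: ominus_eq lam_le oplus_le)

section \<open>Identities of the truncated difference\<close>

lemma zero_oplus [simp]: "0 \<oplus> (x::'a::emv_algebra) = x"
  by (metis oplus_comm oplus_zero)

lemma oplus_left_comm: "(x::'a::emv_algebra) \<oplus> (y \<oplus> w) = y \<oplus> (x \<oplus> w)"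
  by (metis oplus_assoc oplus_comm)

lemmas oplus_ac = oplus_assoc oplus_comm oplus_left_comm

lemma join_comm: "x \<oplus> (y \<ominus> x) = y \<oplus> (x \<ominus> y)"
proof -
  obtain b where b: "idem b" "x \<le> b" "y \<le> b" by (rule idem_bound3)
  show ?thesis using lam_luk[OF b] by (simp add: ominus_eq[of b] b oplus_comm)
qed

lemma ominus_ominus: "x \<ominus> y \<ominus> w = x \<ominus> (y \<oplus> w)"
proof -
  obtain b where b: "idem b" "x \<le> b" "y \<le> b" "w \<le> b" by (rule idem_bound3)
  show ?thesis using ominus_le[of b x y]
    by (simp add: ominus_eq[of b] b oplus_le lam_le lam_lam oplus_assoc)
qed

lemma ominus_self [simp]: "x \<ominus> x = 0"
proof -
  obtain b where b: "idem b" "x \<le> b" using below_idem by blast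
  show ?thesis by (simp add: ominus_eq[of b] b lam_oplus lam_self)
qed

lemma zero_ominus [simp]: "0 \<ominus> x = 0"
proof -
  obtain b where b: "idem b" "x \<le> b" using below_idem by blast
  show ?thesis
    by (simp add: ominus_eq[of b] b lam_zero oplus_comm[of b] oplus_top lam_self)
qed

lemma ominus_zero [simp]: "x \<ominus> 0 = x"
  using join_comm[of x 0] by simp

text \<open>The Lukasiewicz axiom for the complements of \<open>x\<close> and \<open>y\<close>, just
  as \<open>join_comm\<close> is that axiom for \<open>x\<close> and \<open>y\<close>
  themselves.\<close>

lemma meet_comm: "x \<ominus> (x \<ominus> y) = y \<ominus> (y \<ominus> x)"
proof -
  obtain b where b: "idem b" "x \<le> b" "y \<le> b" by (rule idem_bound3)
  show ?thesis using lam_luk[OF b(1) lam_le lam_le, of x y] b ominus_le[of b x y] ominus_le[of b y x]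
    by (simp add: ominus_eq[of b] lam_lam oplus_le lam_le oplus_comm)
qed

text \<open>Forward, \<open>a\<close> absorbs every element of \<open>[0,a]\<close>. Backward, the
  sum of \<open>a\<close> with \<open>lam b x\<close> is \<open>b\<close>, and \<open>x\<close> is
  the least element with this property in the lattice order.\<close>

lemma le_idem_iff_nle: "idem a \<Longrightarrow> x \<le> a \<longleftrightarrow> x \<sqsubseteq> a"
proof
  assume a: "idem a" "x \<le> a"
  then show "x \<sqsubseteq> a" by (simp add: nle_def ominus_eq[of a] lam_le oplus_top lam_self)
next
  assume a: "idem a" and "x \<sqsubseteq> a"
  obtain b where b: "idem b" "x \<le> b" "a \<le> b" by (rule idem_bound3)
  have "lam b (lam b x \<oplus> a) = 0" using \<open>x \<sqsubseteq> a\<close> by (simp add: nle_def ominus_eq[of b] b)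
  then have "lam b x \<oplus> a = b"
    by (metis b lam_lam lam_le lam_zero oplus_le)
  then have "lam b (lam b x) \<le> a"
    using lam_props(3)[of b "lam b x" a] b by (simp add: lam_le oplus_comm)
  then show "x \<le> a" by (simp add: b lam_lam)
qed

text \<open>Reduces products to truncated differences over any common idempotent bound, so that the
  laws of the latter carry over.\<close>

lemma odot_eq: "idem a \<Longrightarrow> x \<sqsubseteq> a \<Longrightarrow> y \<sqsubseteq> a \<Longrightarrow> x \<odot> y = x \<ominus> (a \<ominus> y)"
  by (simp add: le_idem_iff_nle[symmetric] odot_eq_odot_in[of a] odot_in_def ominus_eq[of a]
      lam_self lam_le)

section \<open>The order of the truncated difference\<close>

lemma nle_refl [simp]: "x \<sqsubseteq> x"
  and zero_nle [simp]: "0 \<sqsubseteq> x"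
  by (simp_all add: nle_def)

lemma nle_zero [simp]: "x \<sqsubseteq> 0 \<longleftrightarrow> x = 0"
  by (simp add: nle_def)

lemma ominus_nle_iff: "x \<ominus> y \<sqsubseteq> w \<longleftrightarrow> x \<sqsubseteq> y \<oplus> w"
  by (simp add: nle_def ominus_ominus)

lemma nle_antisym: "x \<sqsubseteq> y \<Longrightarrow> y \<sqsubseteq> x \<Longrightarrow> x = y"
  using join_comm[of x y] by (simp add: nle_def)

lemma nle_oplus_ominus: "x \<sqsubseteq> y \<Longrightarrow> x \<oplus> (y \<ominus> x) = y"
  using join_comm[of x y] by (simp add: nle_def)

lemma nle_ominus_ominus: "x \<sqsubseteq> y \<Longrightarrow> y \<ominus> (y \<ominus> x) = x"
  using meet_comm[of x y] by (simp add: nle_def)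

lemma nle_oplus [simp]: "x \<sqsubseteq> x \<oplus> y" "x \<sqsubseteq> y \<oplus> x"
  by (metis ominus_nle_iff ominus_self zero_nle oplus_comm)+

lemma nle_trans [trans]: "x \<sqsubseteq> y \<Longrightarrow> y \<sqsubseteq> w \<Longrightarrow> x \<sqsubseteq> w"
  by (metis nle_def nle_oplus_ominus ominus_ominus zero_ominus)

lemma oplus_mono: "x \<sqsubseteq> x' \<Longrightarrow> y \<sqsubseteq> y' \<Longrightarrow> x \<oplus> y \<sqsubseteq> x' \<oplus> y'"
proof -
  assume "x \<sqsubseteq> x'" "y \<sqsubseteq> y'"
  then have "x' \<oplus> y' = (x \<oplus> (x' \<ominus> x)) \<oplus> (y \<oplus> (y' \<ominus> y))"
    by (simp add: nle_oplus_ominus)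
  also have "\<dots> = (x \<oplus> y) \<oplus> ((x' \<ominus> x) \<oplus> (y' \<ominus> y))" by (simp add: oplus_ac)
  finally show ?thesis by simp
qed

lemma ominus_nle [simp]: "x \<ominus> y \<sqsubseteq> x"
  by (simp add: ominus_nle_iff)

lemma ominus_mono: "x \<sqsubseteq> x' \<Longrightarrow> y' \<sqsubseteq> y \<Longrightarrow> x \<ominus> y \<sqsubseteq> x' \<ominus> y'"
  by (metis ominus_nle_iff nle_trans oplus_mono nle_refl)

section \<open>Meets and cancellation\<close>

text \<open>The infimum for \<open>\<sqsubseteq>\<close> (see \<open>nle_meet_iff\<close>); the
  lattice operation \<open>inf\<close> belongs to the other order.\<close>

definition meet :: "'a::emv_algebra \<Rightarrow> 'a \<Rightarrow> 'a"
  where "meet x y = x \<ominus> (x \<ominus> y)"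

lemma meet_commute: "meet x y = meet y x"
  by (simp add: meet_def meet_comm)

lemma nle_meet_iff: "w \<sqsubseteq> meet x y \<longleftrightarrow> w \<sqsubseteq> x \<and> w \<sqsubseteq> y"
proof
  show "w \<sqsubseteq> meet x y \<Longrightarrow> w \<sqsubseteq> x \<and> w \<sqsubseteq> y"
    by (metis meet_comm meet_def nle_trans ominus_nle)
  show "w \<sqsubseteq> x \<and> w \<sqsubseteq> y \<Longrightarrow> w \<sqsubseteq> meet x y"
    by (metis meet_def nle_ominus_ominus nle_refl ominus_mono)
qed

text \<open>By hypothesis \<open>t\<close> fits into what \<open>x\<close> has left above
  \<open>m\<close>, so the sum is not truncated. Taking the complement of \<open>t\<close> in
  \<open>x \<ominus> m\<close> twice then gives back \<open>t\<close>.\<close>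

lemma oplus_ominus_cancel:
  assumes "m \<sqsubseteq> x" "t \<sqsubseteq> x \<ominus> m"
  shows "(m \<oplus> t) \<ominus> m = t"
proof -
  have mt: "m \<oplus> t \<sqsubseteq> x" by (metis assms nle_oplus_ominus oplus_mono nle_refl)
  have "t = (x \<ominus> m) \<ominus> ((x \<ominus> m) \<ominus> t)" using assms(2) by (simp add: nle_ominus_ominus)
  also have "\<dots> = x \<ominus> (x \<ominus> (m \<oplus> t)) \<ominus> m" by (simp add: ominus_ominus oplus_comm)
  also have "\<dots> = (m \<oplus> t) \<ominus> m" using mt by (simp add: nle_ominus_ominus)
  finally show ?thesis by simp
qed

text \<open>Prelinearity, which makes quotients by prime ideals chains. The meet \<open>t\<close> of
  the two differences can be added to \<open>m\<close> without leaving the lower bounds of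
  \<open>x\<close> and \<open>y\<close>, so \<open>m \<oplus> t \<sqsubseteq> m\<close>, and
  cancellation gives \<open>t = 0\<close>.\<close>

lemma meet_ominus_ominus: "meet (x \<ominus> y) (y \<ominus> x) = 0"
proof -
  define m where "m = meet x y"
  define t where "t = meet (x \<ominus> y) (y \<ominus> x)"
  have "m \<sqsubseteq> x" "m \<sqsubseteq> y" using nle_meet_iff[of m x y] by (simp_all add: m_def)
  have "x \<ominus> y = x \<ominus> m" "y \<ominus> x = y \<ominus> m"
    by (metis m_def meet_def meet_commute nle_ominus_ominus ominus_nle)+
  then have t: "t \<sqsubseteq> x \<ominus> m" "t \<sqsubseteq> y \<ominus> m"
    using nle_meet_iff[of t "x \<ominus> y" "y \<ominus> x"] by (simp_all add: t_def)
  have "m \<oplus> t \<sqsubseteq> x" "m \<oplus> t \<sqsubseteq> y"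
    by (metis \<open>m \<sqsubseteq> x\<close> \<open>m \<sqsubseteq> y\<close> t nle_oplus_ominus oplus_mono nle_refl)+
  then have "m \<oplus> t \<sqsubseteq> m" by (simp add: m_def nle_meet_iff)
  then have "(m \<oplus> t) \<ominus> m = 0" by (simp add: nle_def)
  then show ?thesis
    using oplus_ominus_cancel[OF \<open>m \<sqsubseteq> x\<close> t(1)] by (simp add: t_def)
qed

text \<open>Subtracting from \<open>?t\<close> its part below \<open>x\<close> leaves something
  below both \<open>y\<close> and \<open>w\<close>. This closes sets of the form
  \<open>{y. meet y b \<in> P}\<close> under sums.\<close>

lemma meet_oplus_nle: "meet (x \<oplus> y) w \<sqsubseteq> meet x w \<oplus> meet y w"
proof -
  let ?t = "meet (x \<oplus> y) w"
  have t: "?t \<sqsubseteq> x \<oplus> y" "?t \<sqsubseteq> w" using nle_meet_iff[of ?t "x \<oplus> y" w] by auto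
  have "?t \<ominus> meet x ?t = ?t \<ominus> x"
    by (metis meet_commute meet_def nle_ominus_ominus ominus_nle)
  also have "\<dots> \<sqsubseteq> meet y w"
    by (metis t nle_meet_iff nle_trans ominus_nle ominus_nle_iff)
  finally have "?t \<sqsubseteq> meet x ?t \<oplus> meet y w" by (simp add: ominus_nle_iff)
  also have "\<dots> \<sqsubseteq> meet x w \<oplus> meet y w"
    by (metis t(2) meet_commute meet_def nle_refl ominus_mono oplus_mono)
  finally show ?thesis .
qed

section \<open>Complements, products and doubling below an idempotent\<close>

lemma idem_oplus_nle: "idem a \<Longrightarrow> x \<sqsubseteq> a \<Longrightarrow> y \<sqsubseteq> a \<Longrightarrow> x \<oplus> y \<sqsubseteq> a"
  by (metis idem_def oplus_mono)

lemma idem_bound4: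
  obtains a :: "'a::emv_algebra"
  where "idem a" "x \<sqsubseteq> a" "y \<sqsubseteq> a" "w \<sqsubseteq> a" "v \<sqsubseteq> a"
proof -
  obtain a where "idem a" "sup x (sup y (sup w v)) \<le> a" using below_idem by blast
  then have "idem a" "x \<sqsubseteq> a" "y \<sqsubseteq> a" "w \<sqsubseteq> a" "v \<sqsubseteq> a"
    by (simp_all add: le_idem_iff_nle[symmetric])
  then show ?thesis by (rule that)
qed

lemma compl_compl: "x \<sqsubseteq> a \<Longrightarrow> a \<ominus> (a \<ominus> x) = x"
  by (rule nle_ominus_ominus)

lemma odot_eq_compl:
  assumes "idem a" "x \<sqsubseteq> a" "y \<sqsubseteq> a"
  shows "x \<odot> y = a \<ominus> ((a \<ominus> x) \<oplus> (a \<ominus> y))"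
  by (metis assms compl_compl odot_eq ominus_ominus)

lemma odot_comm: "x \<odot> y = y \<odot> (x::'a::emv_algebra)"
proof -
  obtain a where "idem a" "x \<sqsubseteq> a" "y \<sqsubseteq> a" by (rule idem_bound4)
  then show ?thesis by (simp add: odot_eq_compl[of a] oplus_comm)
qed

lemma odot_nle [simp]: "x \<odot> y \<sqsubseteq> x"
proof -
  obtain a where "idem a" "x \<sqsubseteq> a" "y \<sqsubseteq> a" by (rule idem_bound4)
  then show ?thesis by (simp add: odot_eq[of a])
qed

lemma zero_odot [simp]: "0 \<odot> x = (0::'a::emv_algebra)"
  using odot_nle[of 0 x] by simp

lemma odot_zero [simp]: "x \<odot> 0 = (0::'a::emv_algebra)"
  using zero_odot odot_comm by metis

lemma compl_odot:
  assumes "idem a" "x \<sqsubseteq> a" "y \<sqsubseteq> a"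
  shows "a \<ominus> (x \<odot> y) = (a \<ominus> x) \<oplus> (a \<ominus> y)"
  using assms by (simp add: odot_eq_compl[of a] compl_compl idem_oplus_nle)

lemma compl_oplus:
  assumes "idem a" "x \<sqsubseteq> a" "y \<sqsubseteq> a"
  shows "a \<ominus> (x \<oplus> y) = (a \<ominus> x) \<odot> (a \<ominus> y)"
  using assms by (simp add: odot_eq[of a] compl_compl ominus_ominus)

lemma idem_odot: "idem a \<Longrightarrow> a \<odot> a = a"
  by (simp add: odot_eq[of a])

lemma nle_compl_swap: "x \<sqsubseteq> a \<Longrightarrow> y \<sqsubseteq> a \<Longrightarrow> y \<sqsubseteq> a \<ominus> x \<Longrightarrow> x \<sqsubseteq> a \<ominus> y"
  by (metis compl_compl nle_refl ominus_mono)

text \<open>Guards the next lemmas against truncation: \<open>a \<ominus> x\<close> is made up of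
  \<open>y \<ominus> x\<close> and \<open>a \<ominus> y\<close>.\<close>

lemma oplus_nle_compl:
  assumes "x \<sqsubseteq> y" "y \<sqsubseteq> a" "w \<sqsubseteq> a \<ominus> y"
  shows "(y \<ominus> x) \<oplus> w \<sqsubseteq> a \<ominus> x"
proof -
  have "y = x \<oplus> (y \<ominus> x)" using assms(1) by (simp add: nle_oplus_ominus)
  then have "a \<ominus> y = a \<ominus> x \<ominus> (y \<ominus> x)" by (metis ominus_ominus)
  moreover have "y \<ominus> x \<sqsubseteq> a \<ominus> x" using assms by (simp add: ominus_mono)
  ultimately show ?thesis by (metis assms(3) nle_oplus_ominus nle_refl oplus_mono)
qed

lemma oplus_ominus_assoc:
  assumes "x \<sqsubseteq> y" "y \<sqsubseteq> a" "w \<sqsubseteq> a \<ominus> y"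
  shows "(y \<oplus> w) \<ominus> x = (y \<ominus> x) \<oplus> w"
proof -
  have "y \<oplus> w = x \<oplus> ((y \<ominus> x) \<oplus> w)"
    using assms(1) by (metis nle_oplus_ominus oplus_assoc)
  moreover have "x \<sqsubseteq> a" using assms nle_trans by blast
  ultimately show ?thesis
    using oplus_ominus_cancel[OF _ oplus_nle_compl[OF assms]] by metis
qed

text \<open>The last hypothesis puts \<open>y\<close> in the lower half below \<open>a\<close>,
  where doubling is not truncated. The two copies of \<open>x\<close> are subtracted one after the
  other.\<close>

lemma double_ominus:
  assumes "x \<sqsubseteq> y" "y \<sqsubseteq> a" "y \<sqsubseteq> a \<ominus> y"
  shows "(y \<oplus> y) \<ominus> (x \<oplus> x) = (y \<ominus> x) \<oplus> (y \<ominus> x)"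
proof -
  have "(y \<oplus> y) \<ominus> x = y \<oplus> (y \<ominus> x)"
    using oplus_ominus_assoc[OF assms] by (simp add: oplus_comm)
  moreover have "y \<ominus> x \<sqsubseteq> a \<ominus> y" using assms(3) nle_trans ominus_nle by blast
  ultimately show ?thesis
    using oplus_ominus_assoc[OF assms(1,2)] by (metis ominus_ominus)
qed

text \<open>In the lower half, doubling \<open>x \<oplus> y\<close> has the same carry as adding the
  two doubles. With \<open>y = x \<oplus> d\<close> one has
  \<open>x \<oplus> y = (x \<oplus> x) \<oplus> d\<close> and \<open>a \<ominus> (x \<oplus> y) = d
  \<oplus> (a \<ominus> (y \<oplus> y))\<close>; in the difference of the two, \<open>d\<close>
  cancels.\<close>

lemma odot_double:
  assumes a: "idem a" and xy: "x \<sqsubseteq> y" and y: "y \<sqsubseteq> a" "y \<sqsubseteq> a \<ominus> y"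
  shows "(x \<oplus> y) \<odot> (x \<oplus> y) = (x \<oplus> x) \<odot> (y \<oplus> y)"
proof -
  define d where "d = y \<ominus> x"
  have x: "x \<sqsubseteq> a" using xy y(1) nle_trans by blast
  have yd: "y = x \<oplus> d" by (simp add: d_def nle_oplus_ominus xy)
  have dy: "d \<sqsubseteq> a \<ominus> y" using y(2) nle_trans ominus_nle unfolding d_def by blast
  have z: "x \<oplus> y \<sqsubseteq> a" and X: "x \<oplus> x \<sqsubseteq> a" and Y: "y \<oplus> y \<sqsubseteq> a"
    using a x y idem_oplus_nle by auto
  have "d \<oplus> y \<sqsubseteq> a \<ominus> x" unfolding d_def by (rule oplus_nle_compl[OF xy y])
  moreover have "(d \<oplus> y) \<ominus> y = d" 
    using oplus_ominus_cancel[OF y(1) dy] by (simp add: oplus_comm)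
  ultimately have dz: "d \<sqsubseteq> a \<ominus> (x \<oplus> y)"
    by (metis nle_refl ominus_mono ominus_ominus)
  have "a \<ominus> (x \<oplus> y) = d \<oplus> (a \<ominus> (y \<oplus> y))"
    using nle_oplus_ominus[OF dz] by (simp add: yd ominus_ominus oplus_ac)
  moreover have "x \<oplus> y = (x \<oplus> x) \<oplus> d" by (simp add: yd oplus_ac)
  moreover have "d \<sqsubseteq> a \<ominus> (x \<oplus> x)"
    by (rule nle_trans[OF dz]) (simp add: ominus_mono oplus_mono xy)
  then have "((x \<oplus> x) \<oplus> d) \<ominus> d = x \<oplus> x"
    using oplus_ominus_cancel[of d a "x \<oplus> x"] nle_compl_swap X
    by (metis nle_trans ominus_nle oplus_comm)
  ultimately have "(x \<oplus> y) \<ominus> (a \<ominus> (x \<oplus> y)) = (x \<oplus> x) \<ominus> (a \<ominus> (y \<oplus> y))"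
    by (metis ominus_ominus)
  then show ?thesis using a X Y z by (simp add: odot_eq[of a])
qed

section \<open>Prime ideals and the states they induce\<close>

text \<open>Primeness is stated for disjoint pairs, such as those of
  \<open>meet_ominus_ominus\<close>. The excluded idempotent \<open>c\<close> becomes the unit of
  the quotient, see \<open>idem_eqv\<close>.\<close>

locale prime_ideal =
  fixes P :: "'a::emv_algebra set" and c :: 'a
  assumes zero_mem [simp]: "0 \<in> P"
    and down: "y \<in> P \<Longrightarrow> x \<sqsubseteq> y \<Longrightarrow> x \<in> P"
    and oplus_mem: "x \<in> P \<Longrightarrow> y \<in> P \<Longrightarrow> x \<oplus> y \<in> P"
    and prime: "meet x y = 0 \<Longrightarrow> x \<in> P \<or> y \<in> P"
    and idem_c: "idem c"
    and c_not_mem: "c \<notin> P"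

text \<open>Zorn's lemma gives an ideal maximal among those avoiding \<open>c\<close>; comparing it
  with its ideal quotients shows that it is prime.\<close>

lemma prime_ideal_exists:
  fixes c :: "'a::emv_algebra"
  assumes c: "idem c" "c \<noteq> 0"
  shows "\<exists>P. prime_ideal P c"
proof -
  define A where "A = {P :: 'a set. 0 \<in> P \<and> (\<forall>x y. y \<in> P \<longrightarrow> x \<sqsubseteq> y \<longrightarrow> x \<in> P) \<and>
    (\<forall>x y. x \<in> P \<longrightarrow> y \<in> P \<longrightarrow> x \<oplus> y \<in> P) \<and> c \<notin> P}"
  have "\<exists>M\<in>A. \<forall>X\<in>A. M \<subseteq> X \<longrightarrow> X = M"
  proof (rule subset_Zorn_nonempty)
    have "{0} \<in> A" using c by (simp add: A_def)
    then show "A \<noteq> {}" by blast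
  next
    fix C assume C: "C \<noteq> {}" "subset.chain A C"
    then have CA: "C \<subseteq> A" and tot: "\<And>X Y. X \<in> C \<Longrightarrow> Y \<in> C \<Longrightarrow> X \<subseteq> Y \<or> Y \<subseteq> X"
      by (auto simp: subset.chain_def)
    have "x \<oplus> y \<in> \<Union>C" if xy: "x \<in> \<Union>C" "y \<in> \<Union>C" for x y
    proof -
      from xy obtain X Y where "X \<in> C" "Y \<in> C" "x \<in> X" "y \<in> Y" by blast
      then obtain Z where "Z \<in> C" "x \<in> Z" "y \<in> Z" using tot by blast
      then show ?thesis using CA by (auto simp: A_def)
    qed
    moreover have "0 \<in> \<Union>C" using C CA by (auto simp: A_def)
    moreover have "x \<in> \<Union>C" if "y \<in> \<Union>C" "x \<sqsubseteq> y" for x y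
    proof -
      from that obtain X where "X \<in> C" "y \<in> X" by blast
      moreover from this have "x \<in> X" using CA \<open>x \<sqsubseteq> y\<close> unfolding A_def by blast
      ultimately show ?thesis by blast
    qed
    moreover have "c \<notin> \<Union>C" using CA by (auto simp: A_def)
    ultimately show "\<Union>C \<in> A" unfolding A_def by blast
  qed
  then obtain P where PA: "P \<in> A" and max: "\<And>X. X \<in> A \<Longrightarrow> P \<subseteq> X \<Longrightarrow> X = P" by blast
  have down: "\<And>x y. y \<in> P \<Longrightarrow> x \<sqsubseteq> y \<Longrightarrow> x \<in> P" and zero: "0 \<in> P" and cP: "c \<notin> P"
    and opl: "\<And>x y. x \<in> P \<Longrightarrow> y \<in> P \<Longrightarrow> x \<oplus> y \<in> P"
    using PA by (auto simp: A_def)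
  \<comment> \<open>The set \<open>{y. meet y b \<in> P}\<close> is an ideal that contains
    \<open>P\<close> and, by \<open>cb\<close>, avoids \<open>c\<close>; maximality makes it equal
    to \<open>P\<close>.\<close>
  have quot: "x \<in> P" if x: "meet x b \<in> P" and cb: "meet c b \<notin> P" for x b
  proof -
    have mono: "meet u b \<sqsubseteq> meet v b" if "u \<sqsubseteq> v" for u v
      using that nle_meet_iff[of "meet u b" u b] by (auto simp: nle_meet_iff intro: nle_trans)
    have "u \<oplus> v \<in> {y. meet y b \<in> P}" if "u \<in> {y. meet y b \<in> P}" "v \<in> {y. meet y b \<in> P}" for u v
      using down[OF opl meet_oplus_nle] that by blast
    moreover have "u \<in> {y. meet y b \<in> P}" if "v \<in> {y. meet y b \<in> P}" "u \<sqsubseteq> v" for u v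
      using down[OF _ mono[OF that(2)]] that(1) by blast
    moreover have "0 \<in> {y. meet y b \<in> P}" by (simp add: meet_def zero)
    moreover have "c \<notin> {y. meet y b \<in> P}" using cb by blast
    ultimately have "{y. meet y b \<in> P} \<in> A" unfolding A_def by blast
    moreover have "P \<subseteq> {y. meet y b \<in> P}"
      using down by (auto simp: meet_def)
    ultimately show ?thesis using max x by blast
  qed
  have "x \<in> P \<or> y \<in> P" if "meet x y = 0" for x y
  \<comment> \<open>The first case takes \<open>b = c\<close> in \<open>quot\<close>, where
    \<open>meet c c = c\<close>; the second takes \<open>b = y\<close>, where
    \<open>meet x y = 0\<close>.\<close>
  proof (cases "meet c y \<in> P")
    case True
    have "meet c c \<notin> P" using cP by (simp add: meet_def)
    then show ?thesis using quot[of y c] True by (simp add: meet_commute)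
  next
    case False
    then show ?thesis using quot[of x y] that zero by simp
  qed
  then have "prime_ideal P c" using c(1) cP down zero opl by (intro prime_ideal.intro)
  then show ?thesis by blast
qed

section \<open>The chain modulo a prime ideal\<close>

context prime_ideal
begin

definition eqv :: "'a \<Rightarrow> 'a \<Rightarrow> bool"  (infix \<open>\<doteq>\<close> 50)
  where "x \<doteq> y \<longleftrightarrow> x \<ominus> y \<in> P \<and> y \<ominus> x \<in> P"

lemma eqv_refl [simp]: "x \<doteq> x" by (simp add: eqv_def)

lemma eqv_sym: "x \<doteq> y \<Longrightarrow> y \<doteq> x" by (simp add: eqv_def)

lemma eqv_trans: "x \<doteq> y \<Longrightarrow> y \<doteq> w \<Longrightarrow> x \<doteq> w"
proof -
  have "u \<ominus> w \<sqsubseteq> (u \<ominus> v) \<oplus> (v \<ominus> w)" for u v w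
  proof -
    have "u \<sqsubseteq> v \<oplus> (u \<ominus> v)" "v \<sqsubseteq> w \<oplus> (v \<ominus> w)"
      by (simp_all add: ominus_nle_iff[symmetric])
    then have "u \<sqsubseteq> w \<oplus> (v \<ominus> w) \<oplus> (u \<ominus> v)"
      by (metis nle_refl nle_trans oplus_mono)
    then show ?thesis by (simp add: ominus_nle_iff oplus_ac)
  qed
  then show "x \<doteq> y \<Longrightarrow> y \<doteq> w \<Longrightarrow> x \<doteq> w"
    unfolding eqv_def by (meson down oplus_mem)
qed

lemma eqv_oplus: "x \<doteq> x' \<Longrightarrow> y \<doteq> y' \<Longrightarrow> x \<oplus> y \<doteq> x' \<oplus> y'"
proof -
  have *: "(u \<oplus> w) \<ominus> (v \<oplus> w) \<sqsubseteq> u \<ominus> v" for u v w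
  proof -
    have "u \<sqsubseteq> v \<oplus> (u \<ominus> v)" by (simp add: ominus_nle_iff[symmetric])
    then have "u \<oplus> w \<sqsubseteq> v \<oplus> (u \<ominus> v) \<oplus> w" by (simp add: oplus_mono)
    then show ?thesis by (simp add: ominus_nle_iff oplus_ac)
  qed
  have "u \<oplus> w \<doteq> v \<oplus> w" if "u \<doteq> v" for u v w
    using that * unfolding eqv_def by (meson down)
  then show "x \<doteq> x' \<Longrightarrow> y \<doteq> y' \<Longrightarrow> x \<oplus> y \<doteq> x' \<oplus> y'"
    by (metis eqv_trans oplus_comm)
qed

lemma eqv_ominus: "x \<doteq> x' \<Longrightarrow> y \<doteq> y' \<Longrightarrow> x \<ominus> y \<doteq> x' \<ominus> y'"
proof -
  have 1: "(u \<ominus> w) \<ominus> (v \<ominus> w) \<sqsubseteq> u \<ominus> v" for u v w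
  proof -
    have "u \<sqsubseteq> v \<oplus> (u \<ominus> v)" "v \<sqsubseteq> w \<oplus> (v \<ominus> w)"
      by (simp_all add: ominus_nle_iff[symmetric])
    then have "u \<sqsubseteq> w \<oplus> (v \<ominus> w) \<oplus> (u \<ominus> v)"
      by (metis nle_refl nle_trans oplus_mono)
    then show ?thesis by (simp add: ominus_nle_iff oplus_ac)
  qed
  have 2: "(w \<ominus> u) \<ominus> (w \<ominus> v) \<sqsubseteq> v \<ominus> u" for u v w
  proof -
    have "w \<sqsubseteq> v \<oplus> (w \<ominus> v)" "v \<sqsubseteq> u \<oplus> (v \<ominus> u)"
      by (simp_all add: ominus_nle_iff[symmetric])
    then have "w \<sqsubseteq> u \<oplus> (v \<ominus> u) \<oplus> (w \<ominus> v)"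
      by (metis nle_refl nle_trans oplus_mono)
    then show ?thesis by (simp add: ominus_nle_iff oplus_ac)
  qed
  have "u \<ominus> w \<doteq> v \<ominus> w" "w \<ominus> u \<doteq> w \<ominus> v" if "u \<doteq> v" for u v w
    using that 1 2 unfolding eqv_def by (meson down)+
  then show "x \<doteq> x' \<Longrightarrow> y \<doteq> y' \<Longrightarrow> x \<ominus> y \<doteq> x' \<ominus> y'"
    by (metis eqv_trans)
qed

lemma eqv_odot:
  assumes "x \<doteq> x'" "y \<doteq> y'"
  shows "x \<odot> y \<doteq> x' \<odot> y'"
proof -
  obtain a where "idem a" "x \<sqsubseteq> a" "x' \<sqsubseteq> a" "y \<sqsubseteq> a" "y' \<sqsubseteq> a" by (rule idem_bound4)
  then show ?thesis using assms by (simp add: odot_eq[of a] eqv_ominus)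
qed

lemma eqv_zero_iff: "x \<doteq> 0 \<longleftrightarrow> x \<in> P"
  by (simp add: eqv_def)

lemma mem_cong: "x \<doteq> y \<Longrightarrow> x \<in> P \<longleftrightarrow> y \<in> P"
  by (meson eqv_sym eqv_trans eqv_zero_iff)

text \<open>What \<open>a \<ominus> c\<close> and \<open>c\<close> share can be added to
  \<open>c\<close> without exceeding \<open>c\<close>, hence is zero. As \<open>c\<close> lies
  outside \<open>P\<close>, primeness puts \<open>a \<ominus> c\<close> into \<open>P\<close>. So
  all idempotents above \<open>c\<close> represent the same unit.\<close>

lemma idem_eqv: assumes a: "idem a" "c \<sqsubseteq> a" shows "a \<doteq> c"
proof -
  define t where "t = meet (a \<ominus> c) c"
  have t: "t \<sqsubseteq> a \<ominus> c" "t \<sqsubseteq> c" using nle_meet_iff[of t "a \<ominus> c" c] by (simp_all add: t_def)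
  have "(c \<oplus> t) \<ominus> c = t" by (rule oplus_ominus_cancel[OF a(2) t(1)])
  moreover have "c \<oplus> t \<sqsubseteq> c" by (simp add: idem_oplus_nle idem_c t(2))
  ultimately have "t = 0" by (simp add: nle_def)
  then have "a \<ominus> c \<in> P" using prime[of "a \<ominus> c" c] c_not_mem by (auto simp: t_def)
  then show ?thesis using a(2) by (simp add: eqv_def nle_def)
qed

lemma eqv_meet: "x \<ominus> y \<in> P \<Longrightarrow> x \<doteq> meet x y"
  using ominus_nle[of x "x \<ominus> y", unfolded nle_def] nle_ominus_ominus[OF ominus_nle[of x y]]
  by (simp add: eqv_def meet_def del: ominus_ominus)

lemma total: "x \<ominus> y \<in> P \<or> y \<ominus> x \<in> P"
  by (rule prime) (rule meet_ominus_ominus)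

text \<open>In the chain, \<open>m\<close> is the smaller of \<open>x\<close> and its complement. It
  lies in the lower half exactly and not just modulo \<open>P\<close>, as
  \<open>double_ominus\<close> and \<open>odot_double\<close> require.\<close>

lemma half_representative:
  assumes "x \<sqsubseteq> a"
  obtains x' where "x' \<sqsubseteq> a" "x' \<sqsubseteq> a \<ominus> x'" "x \<doteq> x' \<or> x \<doteq> a \<ominus> x'"
proof -
  define m where "m = meet x (a \<ominus> x)"
  have m: "m \<sqsubseteq> x" "m \<sqsubseteq> a \<ominus> x" using nle_meet_iff[of m x "a \<ominus> x"] by (simp_all add: m_def)
  have "m \<sqsubseteq> a" using m(1) assms nle_trans by blast
  moreover have "m \<sqsubseteq> a \<ominus> m" using m by (meson nle_refl nle_trans ominus_mono)
  moreover have "x \<doteq> m \<or> x \<doteq> a \<ominus> m"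
  proof (cases "x \<ominus> (a \<ominus> x) \<in> P")
    case True
    then show ?thesis by (simp add: eqv_meet m_def)
  next
    case False
    then have "a \<ominus> x \<doteq> m"
      using total[of x "a \<ominus> x"] eqv_meet[of "a \<ominus> x" x] by (simp add: m_def meet_commute)
    then have "a \<ominus> (a \<ominus> x) \<doteq> a \<ominus> m" by (simp add: eqv_ominus)
    then show ?thesis by (simp add: compl_compl assms)
  qed
  ultimately show ?thesis by (rule that)
qed

text \<open>In the totally ordered quotient by \<open>P\<close>, with \<open>c\<close> as unit,
  \<open>dyadic k x\<close> is \<open>x\<close> rounded up to a multiple of \<open>2\<^sup>-\<^sup>k\<close>:
  the carry of \<open>x + x\<close> is \<open>x \<odot> x\<close>. Rounding up is submodular, and its defect on
  complementary pairs is at most \<open>2\<^sup>-\<^sup>k\<close>, so that the limit is additive.\<close>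

primrec dyadic :: "nat \<Rightarrow> 'a \<Rightarrow> real" where
  "dyadic 0 x = of_bool (x \<notin> P)"
| "dyadic (Suc k) x = (dyadic k (x \<oplus> x) + dyadic k (x \<odot> x)) / 2"

lemma dyadic_cong: "x \<doteq> y \<Longrightarrow> dyadic k x = dyadic k y"
proof (induction k arbitrary: x y)
  case 0
  then show ?case by (simp add: mem_cong)
next
  case (Suc k)
  then show ?case using eqv_oplus eqv_odot by (metis dyadic.simps(2))
qed

lemma dyadic_bounds: "0 \<le> dyadic k x" "dyadic k x \<le> 1"
proof (induction k arbitrary: x)
  case (Suc k)
  case 1 show ?case using Suc.IH(1)[of "x \<oplus> x"] Suc.IH(1)[of "x \<odot> x"] by simp
  case 2 show ?case using Suc.IH(2)[of "x \<oplus> x"] Suc.IH(2)[of "x \<odot> x"] by simp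
qed simp_all

lemma dyadic_zero [simp]: "dyadic k 0 = 0"
  by (induction k) simp_all

lemma dyadic_mem: "x \<in> P \<Longrightarrow> dyadic k x = 0"
  using dyadic_cong[of x 0 k] by (simp add: eqv_zero_iff)

lemma dyadic_idem: "idem a \<Longrightarrow> c \<sqsubseteq> a \<Longrightarrow> dyadic k a = 1"
proof (induction k)
  case 0
  then show ?case using c_not_mem mem_cong[OF idem_eqv] by simp
next
  case (Suc k)
  then show ?case by (simp add: idem_odot) (simp add: idem_def)
qed

section \<open>Submodularity of the dyadic approximations\<close>

definition submodular_at :: "nat \<Rightarrow> 'a \<Rightarrow> 'a \<Rightarrow> bool" where
  "submodular_at k x y \<longleftrightarrow> dyadic k (x \<oplus> y) + dyadic k (x \<odot> y) \<le> dyadic k x + dyadic k y"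

lemma submodular_at_commute: "submodular_at k x y \<longleftrightarrow> submodular_at k y x"
  by (simp add: submodular_at_def oplus_comm odot_comm add.commute)

lemma submodular_at_cong:
  "x \<doteq> x' \<Longrightarrow> y \<doteq> y' \<Longrightarrow> submodular_at k x y \<longleftrightarrow> submodular_at k x' y'"
  unfolding submodular_at_def
  by (simp add: dyadic_cong[OF eqv_oplus, of x x' y y'] dyadic_cong[OF eqv_odot, of x x' y y']
      dyadic_cong[of x x'] dyadic_cong[of y y'])

text \<open>In the lower half, doubling takes level \<open>Suc k\<close> at \<open>x\<close>,
  \<open>y\<close> and their complements to level \<open>k\<close> at \<open>X\<close>,
  \<open>Y\<close> and their complements. The four claims cover the positions of two elements
  relative to the half. In the mixed ones, the sum or the product is expressed by the difference
  \<open>e\<close>, whose double is \<open>Y \<ominus> X\<close>.\<close>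

lemma submodular_step:
  assumes sub: "\<And>x y. submodular_at k x y"
    and a: "idem a" "c \<sqsubseteq> a" and xy: "x \<sqsubseteq> y" and y: "y \<sqsubseteq> a" "y \<sqsubseteq> a \<ominus> y"
  shows "submodular_at (Suc k) x y"
    and "submodular_at (Suc k) (a \<ominus> x) (a \<ominus> y)"
    and "submodular_at (Suc k) x (a \<ominus> y)"
    and "submodular_at (Suc k) y (a \<ominus> x)"
proof -
  have x: "x \<sqsubseteq> a" using xy y(1) nle_trans by blast
  have orth: "u \<odot> v = 0" "(a \<ominus> u) \<oplus> (a \<ominus> v) = a" if "u \<sqsubseteq> y" "v \<sqsubseteq> y" for u v
  proof -
    have u: "u \<sqsubseteq> a" "v \<sqsubseteq> a" using that y(1) nle_trans by blast+
    have "u \<sqsubseteq> a \<ominus> v" using that y(2) by (meson nle_refl nle_trans ominus_mono)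
    then show "u \<odot> v = 0" using u a by (simp add: odot_eq[of a]) (simp add: nle_def)
    then show "(a \<ominus> u) \<oplus> (a \<ominus> v) = a" using compl_odot[OF a(1) u] by simp
  qed
  have [simp]: "dyadic k a = 1" "dyadic (Suc k) a = 1" using a dyadic_idem by blast+
  \<comment> \<open>Below the half the carry \<open>u \<odot> u\<close> is zero; above it the sum
    \<open>(a \<ominus> u) \<oplus> (a \<ominus> u)\<close> is \<open>a\<close>, which contributes
    1.\<close>
  have half: "dyadic (Suc k) u = dyadic k (u \<oplus> u) / 2"
    "dyadic (Suc k) (a \<ominus> u) = (1 + dyadic k (a \<ominus> (u \<oplus> u))) / 2" if u: "u \<sqsubseteq> y" for u
  proof -
    have "u \<sqsubseteq> a" using u y(1) nle_trans by blast
    then show "dyadic (Suc k) u = dyadic k (u \<oplus> u) / 2"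
      "dyadic (Suc k) (a \<ominus> u) = (1 + dyadic k (a \<ominus> (u \<oplus> u))) / 2"
      using orth[OF u u] a by (simp_all add: compl_oplus)
  qed
  define X where "X = x \<oplus> x"
  define Y where "Y = y \<oplus> y"
  have X: "X \<sqsubseteq> a" and Y: "Y \<sqsubseteq> a" and XY: "X \<sqsubseteq> Y"
    using x y xy a by (simp_all add: X_def Y_def idem_oplus_nle oplus_mono)
  define e where "e = y \<ominus> x"
  have e: "e \<sqsubseteq> y" and ee: "e \<oplus> e = Y \<ominus> X"
    using double_ominus[OF xy y] by (simp_all add: e_def X_def Y_def)
  define z where "z = x \<oplus> y"
  have z: "z \<sqsubseteq> a" "z \<oplus> z = X \<oplus> Y" "z \<odot> z = X \<odot> Y"
    using odot_double[OF a(1) xy y] x y a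
    by (simp_all add: z_def X_def Y_def idem_oplus_nle oplus_ac)
  note dx = half(1)[OF xy, folded X_def] and dnx = half(2)[OF xy, folded X_def]
    and dy = half(1)[OF nle_refl, folded Y_def] and dny = half(2)[OF nle_refl, folded Y_def]
  have "dyadic (Suc k) z \<le> dyadic (Suc k) x + dyadic (Suc k) y"
    using sub[of X Y] by (simp add: dx dy z submodular_at_def del: dyadic.simps) (simp add: z)
  then show "submodular_at (Suc k) x y"
    using orth(1)[OF xy nle_refl]
    by (simp add: submodular_at_def z_def del: dyadic.simps)
  have "dyadic (Suc k) (a \<ominus> z) \<le> dyadic (Suc k) (a \<ominus> x) + dyadic (Suc k) (a \<ominus> y) - 1"
  proof -
    have "(a \<ominus> z) \<oplus> (a \<ominus> z) = (a \<ominus> X) \<oplus> (a \<ominus> Y)" "(a \<ominus> z) \<odot> (a \<ominus> z) = (a \<ominus> X) \<odot> (a \<ominus> Y)"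
      using z a X Y by (metis compl_odot compl_oplus)+
    then have "dyadic (Suc k) (a \<ominus> z) \<le> (dyadic k (a \<ominus> X) + dyadic k (a \<ominus> Y)) / 2"
      using sub[of "a \<ominus> X" "a \<ominus> Y"] by (simp add: submodular_at_def)
    moreover have "v \<le> (p + q) / 2 \<Longrightarrow> v \<le> (1 + p) / 2 + (1 + q) / 2 - 1" for v p q :: real
      by (simp add: field_simps)
    ultimately show ?thesis unfolding dnx dny by blast
  qed
  then show "submodular_at (Suc k) (a \<ominus> x) (a \<ominus> y)"
    using orth(2)[OF xy nle_refl] compl_oplus[OF a(1) x y(1)]
    by (simp add: submodular_at_def z_def del: dyadic.simps)
  show "submodular_at (Suc k) x (a \<ominus> y)"
  proof -
    have 1: "x \<oplus> (a \<ominus> y) = a \<ominus> e"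
      using compl_odot[OF a(1) _ y(1), of "a \<ominus> x"] odot_eq[OF a(1) y(1), of "a \<ominus> x"] x
      by (simp add: compl_compl odot_comm e_def)
    have 2: "x \<odot> (a \<ominus> y) = 0"
      using xy a x y by (simp add: odot_eq[of a] compl_compl) (simp add: nle_def)
    have 3: "X \<oplus> (a \<ominus> Y) = a \<ominus> (e \<oplus> e)"
      using compl_odot[OF a(1) _ Y, of "a \<ominus> X"] odot_eq[OF a(1) Y, of "a \<ominus> X"] X
      by (simp add: compl_compl odot_comm ee)
    \<comment> \<open>The product on the left is zero by \<open>2\<close>; its counterpart
      \<open>X \<odot> (a \<ominus> Y)\<close> enters only through nonnegativity.\<close>
    show ?thesis
      using sub[of X "a \<ominus> Y"] dyadic_bounds[of k "X \<odot> (a \<ominus> Y)"]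
      by (simp add: submodular_at_def 1 2 3 half(2)[OF e] dx dny del: dyadic.simps)
        (simp add: field_simps)
  qed
  have top: "v \<oplus> (a \<ominus> u) = a" if "u \<sqsubseteq> a" "u \<sqsubseteq> v" "v \<sqsubseteq> a" for u v
  proof (rule nle_antisym)
    show "v \<oplus> (a \<ominus> u) \<sqsubseteq> a" using that a by (simp add: idem_oplus_nle)
    have "u \<oplus> (a \<ominus> u) \<sqsubseteq> v \<oplus> (a \<ominus> u)" using that by (simp add: oplus_mono)
    then show "a \<sqsubseteq> v \<oplus> (a \<ominus> u)" using that(1) by (simp add: nle_oplus_ominus)
  qed
  show "submodular_at (Suc k) y (a \<ominus> x)"
  proof -
    have 1: "y \<oplus> (a \<ominus> x) = a"
      by (rule top[OF x xy y(1)])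
    have 2: "y \<odot> (a \<ominus> x) = e"
      using a x y by (simp add: odot_eq[of a] compl_compl e_def)
    have 3: "Y \<oplus> (a \<ominus> X) = a"
      by (rule top[OF X XY Y])
    have 4: "Y \<odot> (a \<ominus> X) = e \<oplus> e"
      using a X Y by (simp add: odot_eq[of a] compl_compl ee)
    show ?thesis
      using sub[of Y "a \<ominus> X"]
      by (simp add: submodular_at_def 1 2 3 4 half(1)[OF e] dy dnx del: dyadic.simps)
        (simp add: field_simps)
  qed
qed

lemma submodular: "submodular_at k x y"
proof (induction k arbitrary: x y)
  case (0 x y)
  consider "x \<in> P" | "y \<in> P" | "x \<notin> P" "y \<notin> P" by blast
  then show ?case
  proof cases
    case 1
    then have "submodular_at 0 x y \<longleftrightarrow> submodular_at 0 0 y"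
      by (intro submodular_at_cong) (simp_all add: eqv_zero_iff)
    then show ?thesis by (simp add: submodular_at_def del: dyadic.simps)
  next
    case 2
    then have "submodular_at 0 x y \<longleftrightarrow> submodular_at 0 x 0"
      by (intro submodular_at_cong) (simp_all add: eqv_zero_iff)
    then show ?thesis by (simp add: submodular_at_def del: dyadic.simps)
  next
    case 3
    then show ?thesis by (simp add: submodular_at_def)
  qed
next
  case (Suc k x y)
  obtain a where a: "idem a" "c \<sqsubseteq> a" "x \<sqsubseteq> a" "y \<sqsubseteq> a" by (rule idem_bound4)
  obtain x' where x': "x' \<sqsubseteq> a" "x' \<sqsubseteq> a \<ominus> x'" "x \<doteq> x' \<or> x \<doteq> a \<ominus> x'"
    using half_representative[OF a(3)] by blast
  obtain y' where y': "y' \<sqsubseteq> a" "y' \<sqsubseteq> a \<ominus> y'" "y \<doteq> y' \<or> y \<doteq> a \<ominus> y'"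
    using half_representative[OF a(4)] by blast
  \<comment> \<open>The hypothesis orders \<open>u\<close> and \<open>v\<close> only modulo
    \<open>P\<close>. Replacing \<open>u\<close> by \<open>meet u v\<close> gives a congruent
    element truly below \<open>v\<close>, to which \<open>submodular_step\<close> applies.\<close>
  have all: "submodular_at (Suc k) u v \<and> submodular_at (Suc k) (a \<ominus> u) (a \<ominus> v) \<and>
      submodular_at (Suc k) u (a \<ominus> v) \<and> submodular_at (Suc k) v (a \<ominus> u)"
    if v: "v \<sqsubseteq> a" "v \<sqsubseteq> a \<ominus> v" and "u \<ominus> v \<in> P" for u v
  proof -
    have m: "u \<doteq> meet u v" "a \<ominus> u \<doteq> a \<ominus> meet u v" "meet u v \<sqsubseteq> v"
      using that(3) nle_meet_iff[of "meet u v" u v] by (simp_all add: eqv_meet eqv_ominus)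
    show ?thesis
      using submodular_step[OF Suc.IH a(1,2) m(3) v] m submodular_at_cong eqv_refl by meson
  qed
  from total[of x' y'] have "submodular_at (Suc k) x' y' \<and> submodular_at (Suc k) (a \<ominus> x') (a \<ominus> y') \<and>
      submodular_at (Suc k) x' (a \<ominus> y') \<and> submodular_at (Suc k) (a \<ominus> x') y'"
    using all[of y' x'] all[of x' y'] x' y' submodular_at_commute by blast
  then show ?case using x'(3) y'(3) submodular_at_cong by meson
qed

text \<open>In the chain \<open>x\<close> lies in one of the halves, so of the two defects that are
  averaged at the next level one vanishes. Hence the bound halves with each level.\<close>

lemma dyadic_compl:
  assumes a: "idem a" "c \<sqsubseteq> a"
  shows "x \<sqsubseteq> a \<Longrightarrow> dyadic k x + dyadic k (a \<ominus> x) \<in> {1..1 + 1 / 2 ^ k}"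
proof (induction k arbitrary: x)
  case 0
  have "x \<oplus> (a \<ominus> x) \<notin> P"
    using 0 a c_not_mem mem_cong[OF idem_eqv] by (simp add: nle_oplus_ominus)
  then show ?case using oplus_mem by auto
next
  case (Suc k)
  let ?e = "\<lambda>u. dyadic k u + dyadic k (a \<ominus> u)"
  have e1: "?e u = 1" if "u \<in> P \<or> a \<ominus> u \<in> P" "u \<sqsubseteq> a" for u
  proof -
    have "?e v = 1" if "v \<in> P" for v
    proof -
      have "a \<ominus> v \<doteq> a \<ominus> 0" using that by (intro eqv_ominus) (simp_all add: eqv_zero_iff)
      then have "dyadic k (a \<ominus> v) = 1" using dyadic_cong dyadic_idem[OF a] by (metis ominus_zero)
      then show ?thesis by (simp add: dyadic_mem that)
    qed
    then show ?thesis using that compl_compl[of u a] by (metis add.commute)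
  qed
  have x2: "x \<oplus> x \<sqsubseteq> a" "x \<odot> x \<sqsubseteq> a"
    using Suc.prems a idem_oplus_nle odot_nle nle_trans by blast+
  have "x \<odot> x \<in> P \<or> a \<ominus> (x \<oplus> x) \<in> P"
    using total[of x "a \<ominus> x"] Suc.prems a
    by (simp add: odot_eq[of a] ominus_ominus)
  then have "?e (x \<odot> x) = 1 \<or> ?e (x \<oplus> x) = 1" using e1 x2 by blast
  moreover have "dyadic (Suc k) x + dyadic (Suc k) (a \<ominus> x) = (?e (x \<oplus> x) + ?e (x \<odot> x)) / 2"
    using Suc.prems a by (simp add: compl_oplus compl_odot add_divide_distrib)
  moreover have "?e (x \<oplus> x) \<in> {1..1 + 1 / 2 ^ k}" "?e (x \<odot> x) \<in> {1..1 + 1 / 2 ^ k}"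
    using Suc.IH x2 by blast+
  moreover have "(u + v) / 2 \<in> {1..1 + 1 / 2 ^ Suc k}"
    if "u = 1 \<or> v = 1" "v \<in> {1..1 + 1 / 2 ^ k}" "u \<in> {1..1 + 1 / 2 ^ k}" for u v :: real
    using that by (auto simp: field_simps)
  ultimately show ?case by metis
qed

section \<open>The limit and its additivity\<close>

definition state :: "'a \<Rightarrow> real"
  where "state x = lim (\<lambda>k. dyadic k x)"

text \<open>Submodularity at the pair \<open>x\<close>, \<open>x\<close> says that
  \<open>dyadic k x\<close> decreases in \<open>k\<close>, and it is bounded.\<close>

lemma dyadic_tendsto: "(\<lambda>k. dyadic k x) \<longlonglongrightarrow> state x"
proof -
  have "decseq (\<lambda>k. dyadic k x)"
    using submodular[of _ x x] by (intro decseq_SucI) (simp add: submodular_at_def mult.commute)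
  then have "convergent (\<lambda>k. dyadic k x)"
    using dyadic_bounds by (metis decseq_convergent convergent_def)
  then show ?thesis by (simp add: state_def convergent_LIMSEQ_iff)
qed

lemma state_bounds: "state x \<in> {0..1}"
  using LIMSEQ_le_const[OF dyadic_tendsto] LIMSEQ_le_const2[OF dyadic_tendsto] dyadic_bounds
  by (metis atLeastAtMost_iff)

lemma state_submodular: "state (x \<oplus> y) + state (x \<odot> y) \<le> state x + state y"
  by (rule LIMSEQ_le[OF tendsto_add[OF dyadic_tendsto dyadic_tendsto]
        tendsto_add[OF dyadic_tendsto dyadic_tendsto]])
    (use submodular in \<open>auto simp: submodular_at_def\<close>)

lemma state_idem: "idem a \<Longrightarrow> c \<sqsubseteq> a \<Longrightarrow> state a = 1"
  by (simp add: state_def dyadic_idem)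

lemma state_compl:
  assumes "idem a" "c \<sqsubseteq> a" "x \<sqsubseteq> a"
  shows "state (a \<ominus> x) = 1 - state x"
proof -
  have bounds: "dyadic k x + dyadic k (a \<ominus> x) \<in> {1..1 + 1 / 2 ^ k}" for k
    by (rule dyadic_compl[OF assms])
  have "(\<lambda>k. 1 + (1 / 2) ^ k :: real) \<longlonglongrightarrow> 1 + 0"
    by (intro tendsto_add tendsto_const LIMSEQ_realpow_zero) simp_all
  then have lim: "(\<lambda>k. 1 + 1 / 2 ^ k :: real) \<longlonglongrightarrow> 1"
    by (simp add: power_one_over)
  have "(\<lambda>k. dyadic k x + dyadic k (a \<ominus> x)) \<longlonglongrightarrow> 1"
  proof (rule tendsto_sandwich[OF always_eventually always_eventually tendsto_const lim])
    show "\<forall>k. 1 \<le> dyadic k x + dyadic k (a \<ominus> x)"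
      using bounds by (simp only: atLeastAtMost_iff) blast
    show "\<forall>k. dyadic k x + dyadic k (a \<ominus> x) \<le> 1 + 1 / 2 ^ k"
      using bounds by (simp only: atLeastAtMost_iff) blast
  qed
  moreover have "(\<lambda>k. dyadic k x + dyadic k (a \<ominus> x)) \<longlonglongrightarrow> state x + state (a \<ominus> x)"
    by (intro tendsto_add dyadic_tendsto)
  ultimately show ?thesis using LIMSEQ_unique by fastforce
qed

text \<open>Subadditivity is submodularity with zero product. The reverse inequality is
  submodularity for the complements, whose sum is \<open>a\<close> and whose product is
  \<open>a \<ominus> (x \<oplus> y)\<close>.\<close>

lemma is_state_state: "is_state state"
proof -
  have "state (x \<oplus> y) = state x + state y" if xy: "x \<odot> y = 0" for x y
  proof (rule antisym)
    have "state 0 = 0" by (simp add: state_def)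
    then show "state (x \<oplus> y) \<le> state x + state y" using state_submodular[of x y] xy by simp
    obtain a where a: "idem a" "c \<sqsubseteq> a" "x \<sqsubseteq> a" "y \<sqsubseteq> a" by (rule idem_bound4)
    have "(a \<ominus> x) \<oplus> (a \<ominus> y) = a" using compl_odot[of a x y] a xy by simp
    moreover have "(a \<ominus> x) \<odot> (a \<ominus> y) = a \<ominus> (x \<oplus> y)" using compl_oplus[of a x y] a by simp
    moreover have "x \<oplus> y \<sqsubseteq> a" using a idem_oplus_nle by blast
    ultimately show "state x + state y \<le> state (x \<oplus> y)"
      using state_submodular[of "a \<ominus> x" "a \<ominus> y"] a state_compl state_idem by simp
  qed
  moreover have "state c = 1" by (simp add: state_idem idem_c)
  ultimately show ?thesis using state_bounds unfolding is_state_def by blast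
qed

end

section \<open>The state space\<close>

text \<open>\<open>y\<close> is the partial sum of \<open>y \<ominus> x\<close> and
  \<open>x\<close>, whose product vanishes.\<close>

lemma state_mono:
  assumes s: "is_state s" and "x \<sqsubseteq> y"
  shows "s x \<le> s y"
proof -
  obtain a where a: "idem a" "x \<sqsubseteq> a" "y \<sqsubseteq> a" by (rule idem_bound4)
  have "y \<ominus> x \<sqsubseteq> a" using a(3) nle_trans ominus_nle by blast
  moreover have "y \<ominus> x \<ominus> (a \<ominus> x) = 0"
    using ominus_mono[OF a(3) nle_refl, of x] by (simp add: nle_def del: ominus_ominus)
  ultimately have "(y \<ominus> x) \<odot> x = 0"
    using a by (simp add: odot_eq[of a])
  then have "s ((y \<ominus> x) \<oplus> x) = s (y \<ominus> x) + s x" "0 \<le> s (y \<ominus> x)"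
    using s unfolding is_state_def by auto
  then show ?thesis using nle_oplus_ominus[OF assms(2)] by (simp add: oplus_comm)
qed

lemma state_idem_bound:
  assumes "is_state s" "idem b" "x \<le> b" "s x = 1"
  shows "s b = 1"
  using state_mono[OF assms(1), of x b] assms
  by (metis is_state_def atLeastAtMost_iff le_idem_iff_nle nle_le)

text \<open>An idempotent \<open>a\<close> above both \<open>b\<close> and some \<open>x\<close> not
  below \<open>b\<close> has a nonzero idempotent complement \<open>c\<close> of \<open>b\<close>.
  Since \<open>b \<odot> c = 0\<close>, a state with value 1 at \<open>c\<close> leaves nothing for
  \<open>b\<close>.\<close>

lemma exists_state_vanishing:
  fixes b :: "'a::emv_algebra"
  assumes b: "idem b" and notop: "\<not> (\<forall>x. x \<le> b)"
  shows "\<exists>s :: 'a \<Rightarrow> real. is_state s \<and> s b = 0"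
proof -
  obtain x where x: "\<not> x \<le> b" using notop by blast
  obtain a where a: "idem a" "x \<sqsubseteq> a" "b \<sqsubseteq> a" by (rule idem_bound4)
  define c where "c = a \<ominus> b"
  have "c \<noteq> 0"
    using x a b nle_trans by (metis c_def le_idem_iff_nle nle_def)
  moreover have "idem c"
    using compl_odot[OF a(1) a(3) a(3)] idem_odot[OF b] by (simp add: c_def idem_def)
  ultimately obtain P where "prime_ideal P c" using prime_ideal_exists by blast
  then interpret prime_ideal P c .
  have "state c = 1" by (simp add: state_idem idem_c)
  moreover have "b \<odot> c = 0"
    using a by (simp add: odot_eq[of a] c_def compl_compl)
  then have "state (b \<oplus> c) = state b + state c"
    using is_state_state unfolding is_state_def by blast
  ultimately have "state b = 0"
    using state_bounds[of b] state_bounds[of "b \<oplus> c"] by simp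
  then show ?thesis using is_state_state by blast
qed

lemma is_state_convex:
  assumes s: "is_state s" and t: "is_state t" and d: "0 \<le> d" "d \<le> 1"
  shows "is_state (\<lambda>x. (1 - d) * s x + d * t x)"
proof -
  obtain x y where xy: "s x = 1" "t y = 1" using s t unfolding is_state_def by blast
  \<comment> \<open>\<open>s\<close> and \<open>t\<close> may reach 1 at different elements; a
    common idempotent bound serves both.\<close>
  obtain b where b: "idem b" "x \<le> b" "y \<le> b" by (rule idem_bound3)
  have "(1 - d) * s b + d * t b = 1"
    using state_idem_bound[OF s] state_idem_bound[OF t] b xy by simp
  moreover have "(1 - d) * s x + d * t x \<in> {0..1}" for x
    using s t d convex_bound_le[of "s x" 1 "t x" "1 - d" d] unfolding is_state_def by auto
  moreover have "(1 - d) * s (x \<oplus> y) + d * t (x \<oplus> y) =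
      (1 - d) * s x + d * t x + ((1 - d) * s y + d * t y)" if "x \<odot> y = 0" for x y
  proof -
    have "s (x \<oplus> y) = s x + s y" "t (x \<oplus> y) = t x + t y"
      using s t that unfolding is_state_def by blast+
    then show ?thesis by (simp add: algebra_simps)
  qed
  ultimately show ?thesis unfolding is_state_def by blast
qed

section \<open>The weak topology and the compact case\<close>

abbreviation cube :: "('a \<Rightarrow> real) topology"
  where "cube \<equiv> product_topology (\<lambda>_. top_of_set {0..1}) UNIV"

lemma topspace_cube: "topspace cube = {f. \<forall>x. f x \<in> {0..1}}"
  by (auto simp: PiE_def Pi_def)

lemma topspace_state_space: "topspace state_space = {s. is_state s}"
  unfolding state_space_def topspace_subtopology topspace_cube by (auto simp: is_state_def)

lemma continuous_map_cube_eval: "continuous_map cube euclideanreal (\<lambda>f. f x)"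
  using continuous_map_product_projection[of x UNIV "\<lambda>_. top_of_set {0..1::real}"]
  by (simp add: continuous_map_in_subtopology)

lemma continuous_map_state_space_eval: "continuous_map state_space euclideanreal (\<lambda>s. s x)"
  unfolding state_space_def by (rule continuous_map_from_subtopology[OF continuous_map_cube_eval])

text \<open>That a state takes the value 1 somewhere is an existential condition; with a top
  \<open>t\<close> it becomes the closed condition \<open>f t = 1\<close>.\<close>

lemma compact_state_space:
  fixes t :: "'a::emv_algebra"
  assumes t: "\<forall>x. x \<le> t"
  shows "compact_space (state_space :: ('a \<Rightarrow> real) topology)"
proof -
  have idem: "idem t" using below_idem[of t] t by (metis order_antisym)
  define A :: "'a \<times> 'a \<Rightarrow> ('a \<Rightarrow> real) set" where "A = (\<lambda>(x, y). {f \<in> topspace cube. f (x \<oplus> y) = f x + f y})"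
  have closed_A: "closedin cube (A (x, y))" for x y :: 'a
    unfolding A_def prod.case
    by (intro closedin_continuous_maps_eq[where Y = euclideanreal] continuous_map_add
        continuous_map_cube_eval Hausdorff_space_euclidean)
  have closed_unit: "closedin cube {f \<in> topspace cube. f t = 1}"
    by (intro closedin_continuous_maps_eq[where Y = euclideanreal]
        continuous_map_cube_eval Hausdorff_space_euclidean) simp
  have states: "{s. is_state s} = {f \<in> topspace cube. f t = 1} \<inter> \<Inter>(A ` {(x, y). x \<odot> y = 0})"
  proof (intro equalityI subsetI)
    fix s :: "'a \<Rightarrow> real" assume "s \<in> {s. is_state s}"
    then have s: "is_state s" by simp
    then obtain x where "s x = 1" unfolding is_state_def by blast
    then have "s t = 1" using state_idem_bound[OF s idem] t by blast
    then show "s \<in> {f \<in> topspace cube. f t = 1} \<inter> \<Inter>(A ` {(x, y). x \<odot> y = 0})"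
      using s unfolding is_state_def topspace_cube A_def by blast
  next
    fix s assume "s \<in> {f \<in> topspace cube. f t = 1} \<inter> \<Inter>(A ` {(x, y). x \<odot> y = 0})"
    then show "s \<in> {s. is_state s}"
      unfolding is_state_def topspace_cube A_def by blast
  qed
  have "closedin cube {s :: 'a \<Rightarrow> real. is_state s}"
    unfolding states
  proof (intro closedin_Int closed_unit closedin_INT)
    show "{(x, y :: 'a). x \<odot> y = 0} \<noteq> {}" using zero_odot by blast
  qed (use closed_A in blast)
  moreover have "compact_space (cube :: ('a \<Rightarrow> real) topology)"
    by (simp add: compact_space_product_topology compact_space_subtopology)
  ultimately show ?thesis
    unfolding state_space_def by (intro compact_space_subtopology closedin_compact_space)
qed

section \<open>Local compactness forces a top element\<close>

lemma finite_idem_bound: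
  fixes F :: "'a::emv_algebra set"
  assumes "finite F"
  shows "\<exists>b. idem b \<and> (\<forall>x\<in>F. x \<le> b)"
  using assms
proof induction
  case empty
  then show ?case using below_idem by blast
next
  case (insert x F)
  then obtain b where b: "\<forall>x\<in>F. x \<le> b" by blast
  obtain b' where "idem b'" "x \<le> b'" "b \<le> b'" by (rule idem_bound3)
  then show ?case using b order_trans by blast
qed

lemma top_if_locally_compact_state_space:
  assumes lc: "locally_compact_space (state_space :: ('a::emv_algebra \<Rightarrow> real) topology)"
  shows "\<exists>t::'a. \<forall>x. x \<le> t"
proof (rule ccontr)
  assume "\<nexists>t::'a. \<forall>x. x \<le> t"
  then have vanish: "\<exists>s :: 'a \<Rightarrow> real. is_state s \<and> s b = 0" if "idem b" for b
    using exists_state_vanishing[OF that] by blast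
  obtain s :: "'a \<Rightarrow> real" where s: "is_state s" using vanish below_idem by blast
  then obtain U K where U: "openin state_space U" and K: "compactin state_space K"
    and sU: "s \<in> U" and UK: "U \<subseteq> K"
    using lc unfolding locally_compact_space_def topspace_state_space by blast
  obtain W where W: "openin cube W" and UW: "U = W \<inter> {s. is_state s}"
    using U unfolding state_space_def openin_subtopology by blast
  \<comment> \<open>A basic box around \<open>s\<close>, constrained in finitely many coordinates
    only; these form \<open>F\<close>.\<close>
  obtain V where V: "finite {i. V i \<noteq> {0..1}}" "\<And>i. openin (top_of_set {0..1}) (V i)"
    "s \<in> Pi\<^sub>E UNIV V" "Pi\<^sub>E UNIV V \<subseteq> W"
    using W sU unfolding UW openin_product_topology_alt by fastforce
  define F where "F = {i. V i \<noteq> {0..1}}"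
  \<comment> \<open>Any small positive \<open>d\<close> will do. Only \<open>(1 - d) * s\<close> has
    to stay in the box on \<open>F\<close>, since the state mixed in later vanishes there.\<close>
  have unit: "\<forall>\<^sub>F d in at_right 0. d < 1 \<and> (0::real) < d"
    by (simp add: eventually_at_right_less eventually_at_right_field eventually_conj_iff)
      (meson zero_less_one)
  have "\<forall>\<^sub>F d in at_right 0. (1 - d) * s i \<in> V i" if "i \<in> F" for i
  proof -
    obtain T where T: "open T" "V i = {0..1} \<inter> T"
      using V(2)[of i] unfolding openin_open by blast
    have "((\<lambda>d. (1 - d) * s i) \<longlongrightarrow> (1 - 0) * s i) (at_right 0)"
      by (intro tendsto_intros)
    moreover have "(1 - 0) * s i \<in> T" using V(3) T by (auto simp: PiE_def Pi_def)
    ultimately have "\<forall>\<^sub>F d in at_right 0. (1 - d) * s i \<in> T"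
      using T(1) topological_tendstoD by blast
    with unit show ?thesis
    proof eventually_elim
      case (elim d)
      have "0 \<le> s i" "s i \<le> 1" using s unfolding is_state_def by auto
      then have "(1 - d) * s i \<in> {0..1}" using elim(1) by (auto intro: mult_le_one)
      then show ?case using elim(2) T(2) by blast
    qed
  qed
  then have "\<forall>\<^sub>F d in at_right 0. \<forall>i\<in>F. (1 - d) * s i \<in> V i"
    by (intro eventually_ball_finite[OF V(1)[folded F_def]] ballI)
  from this unit have "\<forall>\<^sub>F d in at_right 0. (\<forall>i\<in>F. (1 - d) * s i \<in> V i) \<and> d < 1 \<and> 0 < d"
    by (rule eventually_conj)
  then obtain d where dV: "\<And>i. i \<in> F \<Longrightarrow> (1 - d) * s i \<in> V i" and d: "d < 1" "0 < d"
    using eventually_happens[of _ "at_right (0::real)"] trivial_limit_at_right_real by blast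

  \<comment> \<open>The threshold depends on \<open>d\<close> alone, which is fixed before any
    \<open>b\<close>. Every state has value 1 at some idempotent, so these sets cover
    \<open>K\<close>.\<close>
  define N where "N b = {r \<in> topspace state_space. r b \<in> {1 - d<..}}" for b :: 'a
  have "openin state_space (N b)" for b
    unfolding N_def
    by (rule openin_continuous_map_preimage[OF continuous_map_state_space_eval]) simp
  moreover have "K \<subseteq> \<Union>(N ` Collect idem)"
  proof
    fix r assume "r \<in> K"
    then have r: "is_state r" "r \<in> topspace state_space"
      using compactin_subset_topspace[OF K] unfolding topspace_state_space by blast+
    obtain x where "r x = 1" using r(1) unfolding is_state_def by blast
    moreover obtain b where b: "idem b" "x \<le> b" using below_idem by blast
    ultimately have "r b = 1" using state_idem_bound[OF r(1)] by blast
    then show "r \<in> \<Union>(N ` Collect idem)" using r(2) b d by (auto simp: N_def)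
  qed
  ultimately obtain C where "finite C" "C \<subseteq> N ` Collect idem" "K \<subseteq> \<Union>C"
    using K unfolding compactin_def by (metis (no_types, lifting) imageE)
  then obtain B where B: "finite B" "B \<subseteq> Collect idem" "K \<subseteq> \<Union>(N ` B)"
    by (metis finite_subset_image)
  \<comment> \<open>The bound dominates \<open>F\<close>, so that mixing in \<open>t\<close> keeps
    \<open>r\<close> in the box, and \<open>B\<close>, so that \<open>r\<close> is at most
    \<open>1 - d\<close> at every index of the subcover.\<close>
  obtain b where b: "idem b" "\<And>x. x \<in> F \<union> B \<Longrightarrow> x \<le> b"
    using finite_idem_bound[of "F \<union> B"] V(1) B(1) by (auto simp: F_def)
  obtain t where t: "is_state t" "t b = 0" using vanish[OF b(1)] by blast
  have t0: "t x = 0" if "x \<le> b" for x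
  proof -
    have "t x \<le> 0" using state_mono[OF t(1), of x b] that b(1) t(2) by (simp add: le_idem_iff_nle)
    then show ?thesis using t(1) unfolding is_state_def by (metis atLeastAtMost_iff order_antisym)
  qed
  define r where "r x = (1 - d) * s x + d * t x" for x
  have r: "is_state r" unfolding r_def using is_state_convex[OF s t(1)] d by simp
  have "r i \<in> V i" for i
  proof (cases "i \<in> F")
    case True
    then show ?thesis using dV t0 b(2) by (simp add: r_def)
  next
    case False
    then show ?thesis using r unfolding F_def is_state_def by simp
  qed
  then have "r \<in> K" using V(4) UK r unfolding UW by (auto simp: PiE_def Pi_def)
  then obtain b' where "b' \<in> B" "r b' > 1 - d" using B(3) unfolding N_def by auto
  moreover have "r b' \<le> 1 - d" if "b' \<in> B" for b'
  proof -
    have "s b' \<le> 1" using s unfolding is_state_def by simp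
    then show ?thesis using t0 b(2) that d by (simp add: r_def mult_left_le)
  qed
  ultimately show False by fastforce
qed

theorem theorem4p11:
  "(locally_compact_space (state_space :: ('a::emv_algebra \<Rightarrow> real) topology)
      \<longleftrightarrow> compact_space (state_space :: ('a \<Rightarrow> real) topology)) \<and>
   (compact_space (state_space :: ('a \<Rightarrow> real) topology)
      \<longleftrightarrow> (\<exists>t::'a. \<forall>x. x \<le> t))"
  using top_if_locally_compact_state_space compact_state_space compact_imp_locally_compact_space
  by blast

end
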